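(* Let $G$ be an $n$-vertex graph with $\lambda(G)\ge\lambda(T_{n,2})$ and $G\neq T_{n,2}$. Then $$\operatorname{bk}(G)\ \ge\ \frac13\lambda(G).$$ Consequently, if $G$ is an $n$-vertex graph with $\lambda(G)>\lambda(T_{n,2})$, then $\operatorname{bk}(G)\ge\left\lfloor\frac n6\right\rfloor+1$.
   Context: Graphs are finite and simple. $\lambda(G)$ is the spectral radius of the adjacency matrix of $G$. The booksize is $\operatorname{bk}(G)=\max_{uv\in E(G)}|N(u)\cap N(v)|$, the maximum number of triangles sharing a common edge. $T_{n,2}$ is the balanced complete bipartite graph on $n$ vertices, with parts of sizes $\lfloor n/2\rfloor$ and $\lceil n/2\rceil$; $G\ne T_{n,2}$ means that $G$ is not isomorphic to $T_{n,2}$. *)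

theory Defs
  imports
    Graph_Theory.Graph_Theory
    Jordan_Normal_Form.Spectral_Radius
begin

text \<open>
  Finite simple graphs are the symmetric digraphs of the locale \<^locale>\<open>graph\<close> (finite, no loops,
  no parallel arcs), an edge being a pair of opposite arcs.  Isomorphism is \<^const>\<open>digraph_iso\<close>.
\<close>

definition adjacency_mat :: "('a, 'b) pre_digraph \<Rightarrow> 'a list \<Rightarrow> complex mat" where
  "adjacency_mat G xs =
     mat (length xs) (length xs) (\<lambda>(i, j). if xs ! i \<rightarrow>\<^bsub>G\<^esub> xs ! j then 1 else 0)"

text \<open>
  The rows are indexed by an arbitrarily chosen enumeration of the vertices;
  \<open>graph_spectral_radius_eq\<close> below shows that the choice is irrelevant.
\<close>

definition graph_spectral_radius :: "('a, 'b) pre_digraph \<Rightarrow> real" where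
  "graph_spectral_radius G =
     spectral_radius (adjacency_mat G (SOME xs. distinct xs \<and> set xs = verts G))"

definition neighborhood :: "('a, 'b) pre_digraph \<Rightarrow> 'a \<Rightarrow> 'a set" where
  "neighborhood G u = {w. u \<rightarrow>\<^bsub>G\<^esub> w}"

text \<open>For an edgeless graph this is the unspecified value \<open>Max {}\<close>.\<close>

definition booksize :: "('a, 'b) pre_digraph \<Rightarrow> nat" where
  "booksize G = Max {card (neighborhood G u \<inter> neighborhood G v) | u v. u \<rightarrow>\<^bsub>G\<^esub> v}"

definition turan_bipartite :: "nat \<Rightarrow> nat pair_pre_digraph" where
  "turan_bipartite n =
     (let U = {..<n div 2}; V = {n div 2..<n}
      in \<lparr> pverts = U \<union> V, parcs = U \<times> V \<union> V \<times> U \<rparr>)"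

lemma complete_bipartite_turan_bipartite:
  "complete_bipartite_digraph (n div 2) (n - n div 2) (with_proj (turan_bipartite n))"
  unfolding complete_bipartite_digraph_pair_def turan_bipartite_def Let_def
  by (intro conjI exI[of _ "{..<n div 2}"] exI[of _ "{n div 2..<n}"]) auto

lemma eigenvalue_adjacency_mat_iff:
  assumes "distinct xs"
  shows "eigenvalue (adjacency_mat G xs) k \<longleftrightarrow>
    (\<exists>f. (\<exists>u\<in>set xs. f u \<noteq> 0) \<and>
         (\<forall>u\<in>set xs. (\<Sum>w\<in>set xs. (if u \<rightarrow>\<^bsub>G\<^esub> w then 1 else 0) * f w) = k * f u))"
    (is "?L \<longleftrightarrow> (\<exists>f. ?R f)")
proof -
  let ?n = "length xs"
  have bij: "bij_betw ((!) xs) {0..<?n} (set xs)"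
    using bij_betw_nth[OF assms, of "{0..<?n}" "set xs"] by (simp add: atLeast0LessThan)
  have sum_nth: "(\<Sum>w\<in>set xs. g w) = (\<Sum>j = 0..<?n. g (xs ! j))" for g :: "'a \<Rightarrow> complex"
    using sum.reindex_bij_betw[OF bij, of g] by simp
  have row: "(adjacency_mat G xs *\<^sub>v v) $ i
      = (\<Sum>j = 0..<?n. (if xs ! i \<rightarrow>\<^bsub>G\<^esub> xs ! j then 1 else 0) * v $ j)"
    if "i < ?n" "v \<in> carrier_vec ?n" for i v
    using that by (auto simp: adjacency_mat_def scalar_prod_def intro!: sum.cong)
  have vec: "eigenvector (adjacency_mat G xs) v k \<longleftrightarrow> ?R f"
    if v: "v \<in> carrier_vec ?n" and f: "\<And>i. i < ?n \<Longrightarrow> f (xs ! i) = v $ i" for v f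
  proof -
    have "v \<noteq> 0\<^sub>v ?n \<longleftrightarrow> (\<exists>u\<in>set xs. f u \<noteq> 0)"
      using v f by (auto simp: vec_eq_iff set_conv_nth)
    moreover have "adjacency_mat G xs *\<^sub>v v = k \<cdot>\<^sub>v v \<longleftrightarrow>
      (\<forall>i<?n. (adjacency_mat G xs *\<^sub>v v) $ i = k * v $ i)"
      using v by (auto simp: vec_eq_iff adjacency_mat_def)
    moreover have "\<dots> \<longleftrightarrow>
      (\<forall>u\<in>set xs. (\<Sum>w\<in>set xs. (if u \<rightarrow>\<^bsub>G\<^esub> w then 1 else 0) * f w) = k * f u)"
      using v f by (simp add: row sum_nth all_set_conv_all_nth)
    ultimately show ?thesis
      using v by (simp add: eigenvector_def adjacency_mat_def)
  qed
  show ?thesis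
  proof
    assume ?L
    then obtain v where e: "eigenvector (adjacency_mat G xs) v k" by (auto simp: eigenvalue_def)
    then have v: "v \<in> carrier_vec ?n" by (simp add: eigenvector_def adjacency_mat_def)
    define f where "f u = v $ (the_inv_into {0..<?n} ((!) xs) u)" for u
    have "f (xs ! i) = v $ i" if "i < ?n" for i
      using that bij by (simp add: f_def the_inv_into_f_f bij_betw_def)
    with vec[OF v, of f] e show "\<exists>f. ?R f" by blast
  next
    assume "\<exists>f. ?R f"
    then obtain f where "?R f" by blast
    with vec[of "Matrix.vec ?n (\<lambda>i. f (xs ! i))" f] show ?L
      by (auto simp: eigenvalue_def)
  qed
qed

lemma graph_spectral_radius_eq:
  assumes "distinct xs" "set xs = verts G"
  shows "graph_spectral_radius G = spectral_radius (adjacency_mat G xs)"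
proof -
  define ys where "ys = (SOME ys. distinct ys \<and> set ys = verts G)"
  have "distinct ys \<and> set ys = verts G"
    unfolding ys_def by (rule someI[of _ xs]) (use assms in simp)
  then have "eigenvalue (adjacency_mat G ys) = eigenvalue (adjacency_mat G xs)"
    using assms by (simp add: fun_eq_iff eigenvalue_adjacency_mat_iff)
  then show ?thesis
    by (simp add: graph_spectral_radius_def ys_def spectral_radius_def spectrum_def)
qed

end

theory Submission
  imports Defs "HOL-Analysis.Convex"
begin

text \<open>
  Write \<open>c(uv)\<close> for the codegree of an edge \<open>uv\<close>, \<open>m\<close> for the number of edges, and for a nonnegative
  weight \<open>y\<close> on the vertices let \<open>Y\<close> be its total mass, \<open>A y\<close> the vector of weighted degrees and \<open>C(uv)\<close>
  the weight of the common neighbourhood of \<open>uv\<close>.  A vertex adjacent to \<open>j\<close> vertices of a triangle is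
  adjacent to at least \<open>j - 1\<close> of its edges, so the \<open>C\<close>-values of the edges of a triangle add up to
  at least the weighted degrees of its vertices minus \<open>Y\<close>.  Summing this over all triangles gives a
  lower bound for the sum of \<open>c C\<close> over the edges.

  For \<open>m \<le> \<lambda>\<^sup>2\<close> take for \<open>y\<close> the modulus of an eigenvector with eigenvalue of modulus \<open>\<lambda>\<close>; only
  \<open>A y \<ge> \<lambda> y\<close> is needed, so no Perron vector has to be found.  With
  \<open>Q(uv) = \<lambda> (y u + y v) - Y \<le> C(uv)\<close> the bound turns into a nonnegative lower bound, a multiple of
  \<open>\<lambda>\<^sup>2 - m\<close>, for the sum of \<open>(c - \<lambda>/3) (C - Q/3)\<close>, whose second factor is nonnegative.  If \<open>c < \<lambda>/3\<close>
  on all edges, then \<open>C = Q = 0\<close> on all edges and \<open>m = \<lambda>\<^sup>2\<close>, which forces the graph to be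
  triangle-free and then, as \<open>m \<ge> \<lfloor>n\<^sup>2/4\<rfloor>\<close>, to be extremal for Mantel's theorem.
  For \<open>m > \<lambda>\<^sup>2\<close> the weight \<open>y = 1\<close> and the sum of \<open>(c - \<lambda>/3) (c - q/2)\<close> with
  \<open>q(uv) = d(u) + d(v) - n\<close> give a contradiction in the same way.
\<close>

section \<open>Weighted edge and triangle sums of a symmetric 0-1 relation\<close>

locale zero_one_symmetric =
  fixes V :: "'a set" and a :: "'a \<Rightarrow> 'a \<Rightarrow> real"
  assumes finite_V: "finite V"
    and zero_one: "\<And>u v. a u v \<in> {0, 1}"
    and sym: "\<And>u v. a u v = a v u"
begin

definition mass :: "('a \<Rightarrow> real) \<Rightarrow> real" where
  "mass y = (\<Sum>u\<in>V. y u)"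

definition deg :: "('a \<Rightarrow> real) \<Rightarrow> 'a \<Rightarrow> real" where
  "deg y u = (\<Sum>w\<in>V. a u w * y w)"

definition codeg :: "('a \<Rightarrow> real) \<Rightarrow> 'a \<Rightarrow> 'a \<Rightarrow> real" where
  "codeg y u v = (\<Sum>w\<in>V. a u w * a v w * y w)"

text \<open>Pairs are ordered: in a simple graph every edge counts twice here and every triangle six
  times in \<open>triangle_sum\<close>, and \<open>mass (deg (\<lambda>_. 1))\<close> is
  \<open>2 m\<close>.\<close>

definition edge_sum :: "('a \<Rightarrow> 'a \<Rightarrow> real) \<Rightarrow> real" where
  "edge_sum f = (\<Sum>u\<in>V. \<Sum>v\<in>V. a u v * f u v)"

definition triangle_sum :: "('a \<Rightarrow> 'a \<Rightarrow> 'a \<Rightarrow> real) \<Rightarrow> real" where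
  "triangle_sum f = (\<Sum>u\<in>V. \<Sum>v\<in>V. \<Sum>w\<in>V. a u v * a u w * a v w * f u v w)"

abbreviation codegree :: "'a \<Rightarrow> 'a \<Rightarrow> real" where
  "codegree \<equiv> codeg (\<lambda>_. 1)"

lemma edge_sum_add: "edge_sum (\<lambda>u v. f u v + g u v) = edge_sum f + edge_sum g"
  by (simp add: edge_sum_def sum.distrib algebra_simps)

lemma edge_sum_cmult: "edge_sum (\<lambda>u v. c * f u v) = c * edge_sum f"
  by (simp add: edge_sum_def sum_distrib_left algebra_simps)

lemma edge_sum_diff: "edge_sum (\<lambda>u v. f u v - g u v) = edge_sum f - edge_sum g"
  by (simp add: edge_sum_def sum_subtractf algebra_simps)

lemmas edge_sum_linear = edge_sum_add edge_sum_diff edge_sum_cmult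

lemma triangle_sum_add:
  "triangle_sum (\<lambda>u v w. f u v w + g u v w) = triangle_sum f + triangle_sum g"
  by (simp add: triangle_sum_def sum.distrib algebra_simps)

lemma triangle_sum_diff:
  "triangle_sum (\<lambda>u v w. f u v w - g u v w) = triangle_sum f - triangle_sum g"
  by (simp add: triangle_sum_def sum_subtractf algebra_simps)

lemma a_nonneg: "0 \<le> a u v"
  using zero_one[of u v] by auto

lemma a_le_1: "a u v \<le> 1"
  using zero_one[of u v] by auto

lemma edge_sum_mono:
  assumes "\<And>u v. u \<in> V \<Longrightarrow> v \<in> V \<Longrightarrow> a u v = 1 \<Longrightarrow> f u v \<le> g u v"
  shows "edge_sum f \<le> edge_sum g"
  unfolding edge_sum_def
proof (intro sum_mono)
  fix u v assume "u \<in> V" "v \<in> V"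
  with assms[of u v] zero_one[of u v] show "a u v * f u v \<le> a u v * g u v" by auto
qed

lemma edge_sum_swap: "edge_sum (\<lambda>u v. f v u) = edge_sum f"
  unfolding edge_sum_def by (subst sum.swap) (simp add: sym)

lemma codeg_swap: "codeg y v u = codeg y u v"
  by (simp add: codeg_def mult.commute)

text \<open>Summing over the third vertex first collects its weight into the weighted codegree of
  the other two.\<close>

lemma triangle_sum_third: "triangle_sum (\<lambda>u v w. f u v * y w) = edge_sum (\<lambda>u v. codeg y u v * f u v)"
  by (simp add: triangle_sum_def edge_sum_def codeg_def sum_distrib_left sum_distrib_right algebra_simps)

text \<open>Together with \<open>triangle_sum_swap12\<close> this yields invariance under every
  permutation of the three vertices.\<close>

lemma triangle_sum_swap23: "triangle_sum (\<lambda>u v w. f u w v) = triangle_sum f"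
proof -
  have "triangle_sum (\<lambda>u v w. f u w v) = (\<Sum>u\<in>V. \<Sum>v\<in>V. \<Sum>w\<in>V. a u w * a u v * a w v * f u w v)"
    unfolding triangle_sum_def by (intro sum.cong refl) (simp add: sym)
  also have "\<dots> = triangle_sum f"
    unfolding triangle_sum_def by (rule sum.cong[OF refl], rule sum.swap)
  finally show ?thesis .
qed

lemma triangle_sum_swap12: "triangle_sum (\<lambda>u v w. f v u w) = triangle_sum f"
proof -
  have "triangle_sum (\<lambda>u v w. f v u w) = (\<Sum>u\<in>V. \<Sum>v\<in>V. \<Sum>w\<in>V. a v u * a v w * a u w * f v u w)"
    unfolding triangle_sum_def by (intro sum.cong refl) (simp add: sym)
  also have "\<dots> = triangle_sum f"
    unfolding triangle_sum_def by (rule sum.swap)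
  finally show ?thesis .
qed

lemma triangle_sum_pair:
  "triangle_sum (\<lambda>u v w. f u v) = edge_sum (\<lambda>u v. codegree u v * f u v)"
  using triangle_sum_third[of f "\<lambda>_. 1"] by simp

text \<open>Both sides sum the weight of one vertex over all triangles; by symmetry it may be the
  third or the first.\<close>

lemma edge_sum_codeg: "edge_sum (codeg y) = edge_sum (\<lambda>u v. codegree u v * y u)"
proof -
  have "edge_sum (codeg y) = triangle_sum (\<lambda>u v w. y w)"
    using triangle_sum_third[of "\<lambda>_ _. 1" y] by simp
  also have "\<dots> = triangle_sum (\<lambda>u v w. y v)" using triangle_sum_swap23[of "\<lambda>u v w. y v"] by simp
  also have "\<dots> = triangle_sum (\<lambda>u v w. y u)" using triangle_sum_swap12[of "\<lambda>u v w. y u"] by simp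
  finally show ?thesis by (simp add: triangle_sum_pair)
qed

lemma edge_sum_fst: "edge_sum (\<lambda>u v. y u) = mass (deg y)"
proof -
  have "edge_sum (\<lambda>u v. y u) = edge_sum (\<lambda>u v. y v)"
    using edge_sum_swap[of "\<lambda>u v. y u"] by simp
  then show ?thesis by (simp add: edge_sum_def mass_def deg_def)
qed

section \<open>Inequalities between weighted degrees and codegrees\<close>

text \<open>Inclusion-exclusion: the vertices adjacent to neither \<open>u\<close> nor
  \<open>v\<close> have nonnegative total weight.\<close>

lemma codeg_ge:
  assumes "\<And>u. u \<in> V \<Longrightarrow> 0 \<le> y u"
  shows "deg y u + deg y v - mass y \<le> codeg y u v"
proof -
  have "0 \<le> (\<Sum>w\<in>V. (1 - a u w) * (1 - a v w) * y w)"
    using a_le_1 assms by (intro sum_nonneg mult_nonneg_nonneg) auto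
  also have "\<dots> = mass y - deg y u - deg y v + codeg y u v"
    by (simp add: mass_def deg_def codeg_def sum_subtractf sum.distrib algebra_simps)
  finally show ?thesis by simp
qed

lemma codeg_nonneg:
  assumes "\<And>u. u \<in> V \<Longrightarrow> 0 \<le> y u"
  shows "0 \<le> codeg y u v"
  unfolding codeg_def using assms a_nonneg by (intro sum_nonneg mult_nonneg_nonneg) auto

lemma triangle_ineq:
  assumes "\<And>u. u \<in> V \<Longrightarrow> 0 \<le> y u"
  shows "deg y u + deg y v + deg y w - mass y \<le> codeg y u v + codeg y u w + codeg y v w"
proof -
  have "0 \<le> (\<Sum>x\<in>V. (a u x * a v x + a u x * a w x + a v x * a w x - a u x - a v x - a w x + 1) * y x)"
  proof (intro sum_nonneg mult_nonneg_nonneg)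
    fix x
    \<comment> \<open>If \<open>x\<close> is adjacent to \<open>j\<close> of the three vertices,
      this is \<open>(j - 1) * (j - 2) / 2\<close>.\<close>
    show "0 \<le> a u x * a v x + a u x * a w x + a v x * a w x - a u x - a v x - a w x + 1"
      using zero_one[of u x] zero_one[of v x] zero_one[of w x] by auto
  qed (use assms in auto)
  also have "\<dots> = codeg y u v + codeg y u w + codeg y v w - deg y u - deg y v - deg y w + mass y"
    by (simp add: mass_def deg_def codeg_def sum_subtractf sum.distrib algebra_simps)
  finally show ?thesis by simp
qed

text \<open>\<open>triangle_ineq\<close> summed over all triangles. By symmetry the three codegree
  terms have equal sums, as do the three degree terms, and summing out the third vertex leaves the
  factor \<open>codegree u v\<close>.\<close>

lemma edge_sum_codegree_ge:
  assumes "\<And>u. u \<in> V \<Longrightarrow> 0 \<le> y u"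
  shows "0 \<le> edge_sum (\<lambda>u v. codegree u v * (3 * codeg y u v - 3 * deg y u + mass y))"
proof -
  let ?C = "codeg y" and ?z = "deg y"
  have "0 \<le> triangle_sum (\<lambda>u v w. ?C u v + ?C u w + ?C v w - (?z u + ?z v + ?z w - mass y))"
    unfolding triangle_sum_def using triangle_ineq[OF assms] a_nonneg
    by (intro sum_nonneg mult_nonneg_nonneg) (auto simp: algebra_simps)
  also have "\<dots> = triangle_sum (\<lambda>u v w. ?C u v) + triangle_sum (\<lambda>u v w. ?C u w)
      + triangle_sum (\<lambda>u v w. ?C v w) - triangle_sum (\<lambda>u v w. ?z u) - triangle_sum (\<lambda>u v w. ?z v)
      - triangle_sum (\<lambda>u v w. ?z w) + triangle_sum (\<lambda>u v w. mass y)"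
    by (simp add: triangle_sum_add triangle_sum_diff)
  also have "triangle_sum (\<lambda>u v w. ?C v w) = triangle_sum (\<lambda>u v w. ?C u w)"
    using triangle_sum_swap12[of "\<lambda>u v w. ?C u w"] by simp
  also have "triangle_sum (\<lambda>u v w. ?C u w) = triangle_sum (\<lambda>u v w. ?C u v)"
    using triangle_sum_swap23[of "\<lambda>u v w. ?C u v"] by simp
  also have "triangle_sum (\<lambda>u v w. ?z w) = triangle_sum (\<lambda>u v w. ?z v)"
    using triangle_sum_swap23[of "\<lambda>u v w. ?z v"] by simp
  also have "triangle_sum (\<lambda>u v w. ?z v) = triangle_sum (\<lambda>u v w. ?z u)"
    using triangle_sum_swap12[of "\<lambda>u v w. ?z u"] by simp
  finally have "0 \<le> edge_sum (\<lambda>u v. 3 * (codegree u v * ?C u v) - 3 * (codegree u v * ?z u) + codegree u v * mass y)"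
    unfolding edge_sum_linear triangle_sum_pair by simp
  then show ?thesis by (simp add: algebra_simps)
qed

section \<open>The case of at most \<open>l\<^sup>2\<close> edges\<close>

lemma edge_sum_codeg_product_ge:
  assumes y: "\<And>u. u \<in> V \<Longrightarrow> 0 \<le> y u"
    and super: "\<And>u. u \<in> V \<Longrightarrow> l * y u \<le> deg y u" and l: "0 \<le> l"
  shows "l / 3 * mass y * (2 * l\<^sup>2 - mass (deg (\<lambda>_. 1)))
    \<le> edge_sum (\<lambda>u v. (3 * codegree u v - l) * (codeg y u v - (l * (y u + y v) - mass y) / 3))"
proof -
  let ?c = codegree
  let ?T1 = "edge_sum (\<lambda>u v. ?c u v)"
  let ?Ty = "edge_sum (\<lambda>u v. ?c u v * y u)"
  let ?TC = "edge_sum (\<lambda>u v. ?c u v * codeg y u v)"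
  have c0: "0 \<le> ?c u v" for u v by (rule codeg_nonneg) simp
  have Tyv: "edge_sum (\<lambda>u v. ?c u v * y v) = ?Ty"
    using edge_sum_swap[of "\<lambda>u v. ?c u v * y u"] by (simp add: codeg_swap)
  have yv: "edge_sum (\<lambda>u v. y v) = edge_sum (\<lambda>u v. y u)"
    using edge_sum_swap[of "\<lambda>u v. y u"] by simp
  have e1: "edge_sum (\<lambda>u v. 1) = mass (deg (\<lambda>_. 1))"
    by (rule edge_sum_fst)
  have Tz: "l * ?Ty \<le> edge_sum (\<lambda>u v. ?c u v * deg y u)"
    unfolding edge_sum_cmult[symmetric]
    by (rule edge_sum_mono) (use super c0 in \<open>simp add: mult.left_commute[of l] mult_left_mono\<close>)
  have "0 \<le> edge_sum (\<lambda>u v. 3 * (?c u v * codeg y u v) - 3 * (?c u v * deg y u) + mass y * ?c u v)"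
    using edge_sum_codegree_ge[of y, OF y] by (simp add: algebra_simps)
  then have slack: "0 \<le> 3 * ?TC - 3 * edge_sum (\<lambda>u v. ?c u v * deg y u) + mass y * ?T1"
    by (simp only: edge_sum_linear)
  have l0: "0 \<le> 2 * (l\<^sup>2 / 3)" by simp
  have Y: "l * mass y \<le> edge_sum (\<lambda>u v. y u)"
    unfolding edge_sum_fst unfolding mass_def sum_distrib_left by (rule sum_mono) (rule super)
  have "edge_sum (\<lambda>u v. (3 * ?c u v - l) * (codeg y u v - (l * (y u + y v) - mass y) / 3))
    = edge_sum (\<lambda>u v. 3 * (?c u v * codeg y u v) - l * (?c u v * y u) - l * (?c u v * y v)
        + mass y * ?c u v - l * codeg y u v + (l\<^sup>2 / 3) * y u + (l\<^sup>2 / 3) * y v - (l * mass y / 3) * 1)"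
    by (intro arg_cong[where f = edge_sum] ext) (simp add: field_simps power2_eq_square)
  \<comment> \<open>The weights of the two ends give \<open>2 * (l * ?Ty)\<close>, and
    \<open>l * codeg y u v\<close> gives a third copy by \<open>edge_sum_codeg\<close>. The divisor
    3 is chosen to make this total match \<open>slack\<close>.\<close>
  also have "\<dots> = 3 * ?TC - 3 * (l * ?Ty) + mass y * ?T1
     + 2 * (l\<^sup>2 / 3) * edge_sum (\<lambda>u v. y u) - l * mass y / 3 * mass (deg (\<lambda>_. 1))"
    unfolding edge_sum_linear Tyv yv edge_sum_codeg e1 by simp
  finally have "edge_sum (\<lambda>u v. (3 * ?c u v - l) * (codeg y u v - (l * (y u + y v) - mass y) / 3))
    \<ge> 2 * (l\<^sup>2 / 3) * (l * mass y) - l * mass y / 3 * mass (deg (\<lambda>_. 1))"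
    using slack Tz mult_left_mono[OF Y l0] by linarith
  moreover have "l / 3 * mass y * (2 * l\<^sup>2 - mass (deg (\<lambda>_. 1)))
    = 2 * (l\<^sup>2 / 3) * (l * mass y) - l * mass y / 3 * mass (deg (\<lambda>_. 1))"
    by (simp add: field_simps power2_eq_square)
  ultimately show ?thesis by linarith
qed

text \<open>On edges the first factor of \<open>P\<close> is negative and the second nonnegative,
  yet the sum of \<open>P\<close> is bounded below by a nonnegative number. So both are zero, and so
  is every summand.\<close>

lemma triangle_free_if_codegree_small:
  assumes y: "\<And>u. u \<in> V \<Longrightarrow> 0 \<le> y u" and mass: "mass y > 0"
    and super: "\<And>u. u \<in> V \<Longrightarrow> l * y u \<le> deg y u" and l: "0 < l"
    and M: "mass (deg (\<lambda>_. 1)) \<le> 2 * l\<^sup>2"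
    and small: "\<And>u v. u \<in> V \<Longrightarrow> v \<in> V \<Longrightarrow> a u v = 1 \<Longrightarrow> 3 * codegree u v < l"
  shows "mass (deg (\<lambda>_. 1)) = 2 * l\<^sup>2"
    and "\<lbrakk>u \<in> V; v \<in> V; w \<in> V; a u v = 1; a u w = 1\<rbrakk> \<Longrightarrow> a v w = 0"
proof -
  let ?c = codegree
  define Q where "Q u v = l * (y u + y v) - mass y" for u v
  define P where "P u v = (3 * ?c u v - l) * (codeg y u v - Q u v / 3)" for u v
  have CQ: "Q u v \<le> codeg y u v" if "u \<in> V" "v \<in> V" for u v
    using codeg_ge[of y u v, OF y] super[OF that(1)] super[OF that(2)] by (simp add: Q_def algebra_simps)
  have C0: "0 \<le> codeg y u v" for u v by (rule codeg_nonneg) (rule y)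
  have le0: "a u v * P u v \<le> 0" if "u \<in> V" "v \<in> V" for u v
    using zero_one[of u v] small[OF that] CQ[OF that] C0[of u v]
    by (auto simp: P_def mult_le_0_iff)
  have low: "l / 3 * mass y * (2 * l\<^sup>2 - mass (deg (\<lambda>_. 1))) \<le> edge_sum P"
    using edge_sum_codeg_product_ge[OF y super] l by (simp add: P_def[abs_def] Q_def)
  moreover have nonneg: "0 \<le> l / 3 * mass y * (2 * l\<^sup>2 - mass (deg (\<lambda>_. 1)))"
    using l mass M by simp
  moreover have up: "edge_sum P \<le> 0"
    unfolding edge_sum_def by (intro sum_nonpos le0)
  ultimately show "mass (deg (\<lambda>_. 1)) = 2 * l\<^sup>2"
    using l mass by (smt (verit) divide_pos_pos mult_pos_pos mult_eq_0_iff)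
  have "edge_sum P = 0" using low nonneg up by linarith
  then have "(\<Sum>u\<in>V. \<Sum>v\<in>V. - (a u v * P u v)) = 0"
    by (simp add: edge_sum_def sum_negf)
  then have P0: "a u v * P u v = 0" if "u \<in> V" "v \<in> V" for u v
    using that le0 finite_V by (subst (asm) sum_nonneg_eq_0_iff; force intro!: sum_nonneg simp: sum_nonneg_eq_0_iff)
  \<comment> \<open>The vanishing factor is the second one: \<open>Q u v = 3 * codeg y u v\<close>.
    With \<open>Q u v \<le> codeg y u v\<close> and \<open>0 \<le> codeg y u v\<close> both are
    zero.\<close>
  have zero: "codeg y u v = 0 \<and> Q u v = 0" if "u \<in> V" "v \<in> V" "a u v = 1" for u v
    using P0[OF that(1,2)] small[OF that] CQ[OF that(1,2)] C0[of u v] that(3) by (auto simp: P_def)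
  assume uvw: "u \<in> V" "v \<in> V" "w \<in> V" "a u v = 1" "a u w = 1"
  show "a v w = 0"
  proof (rule ccontr)
    assume "a v w \<noteq> 0"
    then have vw: "a v w = 1" using zero_one[of v w] by auto
    have "l * (y u + y v) = mass y" "l * (y u + y w) = mass y" "l * (y v + y w) = mass y"
      using zero[of u v] zero[of u w] zero[of v w] uvw vw by (auto simp: Q_def)
    \<comment> \<open>Add the two equations containing \<open>w\<close> and subtract the third. The
      positive weight of \<open>w\<close> then contradicts the vanishing codegree of
      \<open>u\<close> and \<open>v\<close>.\<close>
    then have "2 * (l * y w) = mass y" by (simp add: algebra_simps)
    then have "0 < y w" using mass l by (smt (verit) mult_nonneg_nonpos)
    also have "y w = a u w * a v w * y w" using uvw vw by simp
    also have "\<dots> \<le> codeg y u v"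
      unfolding codeg_def by (rule member_le_sum) (use uvw finite_V y a_nonneg in auto)
    finally show False using zero[of u v] uvw by simp
  qed
qed

section \<open>The case of more than \<open>l\<^sup>2\<close> edges\<close>

lemma exists_codegree_large_if_dense:
  assumes l: "0 < l" and M: "2 * l\<^sup>2 < mass (deg (\<lambda>_. 1))"
    and n: "(card V)\<^sup>2 < 2 * mass (deg (\<lambda>_. 1))"
  shows "\<exists>u\<in>V. \<exists>v\<in>V. a u v = 1 \<and> l < 3 * codegree u v"
proof (rule ccontr)
  assume "\<not> ?thesis"
  then have small: "3 * codegree u v \<le> l" if "u \<in> V" "v \<in> V" "a u v = 1" for u v
    using that by force
  define N where "N = real (card V)"
  let ?c = codegree and ?d = "deg (\<lambda>_. 1)"
  let ?M = "mass ?d"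
  have mass1: "mass (\<lambda>_. 1) = N" by (simp add: mass_def N_def)
  let ?T1 = "edge_sum (\<lambda>u v. ?c u v)"
  let ?Td = "edge_sum (\<lambda>u v. ?c u v * ?d u)"
  let ?TC = "edge_sum (\<lambda>u v. ?c u v * ?c u v)"
  let ?D = "edge_sum (\<lambda>u v. ?d u)"
  have c0: "0 \<le> ?c u v" for u v by (rule codeg_nonneg) simp
  have Tdv: "edge_sum (\<lambda>u v. ?c u v * ?d v) = ?Td"
    using edge_sum_swap[of "\<lambda>u v. ?c u v * ?d u"] by (simp add: codeg_swap)
  have dv: "edge_sum (\<lambda>u v. ?d v) = ?D"
    using edge_sum_swap[of "\<lambda>u v. ?d u"] by simp
  have e1: "edge_sum (\<lambda>u v. 1) = ?M"
    by (rule edge_sum_fst)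
  have "0 \<le> edge_sum (\<lambda>u v. 3 * (?c u v * ?c u v) - 3 * (?c u v * ?d u) + N * ?c u v)"
    using edge_sum_codegree_ge[of "\<lambda>_. 1"] by (simp add: algebra_simps mass1)
  then have slack: "0 \<le> 3 * ?TC - 3 * ?Td + N * ?T1"
    by (simp only: edge_sum_linear)
  have M0: "0 < ?M" using M l by (smt (verit) zero_less_power)
  have N0: "0 < N"
  proof (rule ccontr)
    assume "\<not> 0 < N"
    then have "V = {}" using finite_V by (simp add: N_def)
    then show False using M0 unfolding mass_def by simp
  qed
  \<comment> \<open>Cauchy-Schwarz, as \<open>?D\<close> is the sum of the squared degrees.\<close>
  have D: "?M\<^sup>2 \<le> N * ?D"
  proof -
    have "?M\<^sup>2 \<le> N * (\<Sum>u\<in>V. (?d u)\<^sup>2)"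
      using sum_squared_le_sum_of_squares[of ?d V] by (simp add: mass_def N_def mult.commute)
    also have "(\<Sum>u\<in>V. (?d u)\<^sup>2) = ?D"
      by (simp add: edge_sum_def deg_def[of "\<lambda>_. 1"] sum_distrib_right power2_eq_square)
    finally show ?thesis .
  qed
  \<comment> \<open>The divisor 2 makes the coefficient of \<open>?Td\<close> equal to 3 after
    symmetrisation, as in \<open>slack\<close>. The second factor is nonnegative because the
    codegree is at least 0 and at least \<open>?d u + ?d v - N\<close>.\<close>
  have "edge_sum (\<lambda>u v. (3 * ?c u v - l) * (?c u v - (?d u + ?d v - N) / 2)) \<le> edge_sum (\<lambda>u v. 0)"
  proof (rule edge_sum_mono)
    fix u v assume uv: "u \<in> V" "v \<in> V" "a u v = 1"
    have "0 \<le> ?c u v - (?d u + ?d v - N) / 2"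
      using codeg_ge[of "\<lambda>_. 1" u v] c0[of u v] by (simp add: mass1)
    then show "(3 * ?c u v - l) * (?c u v - (?d u + ?d v - N) / 2) \<le> 0"
      using small[OF uv] by (simp add: mult_le_0_iff)
  qed
  moreover have "edge_sum (\<lambda>u v. (3 * ?c u v - l) * (?c u v - (?d u + ?d v - N) / 2))
    = edge_sum (\<lambda>u v. 3 * (?c u v * ?c u v) - (3 / 2) * (?c u v * ?d u) - (3 / 2) * (?c u v * ?d v)
        + (3 / 2 * N - l) * ?c u v + (l / 2) * ?d u + (l / 2) * ?d v - (l * N / 2) * 1)"
    by (intro arg_cong[where f = edge_sum] ext) (simp add: field_simps)
  moreover have "\<dots> = 3 * ?TC - 3 * ?Td + (3 / 2 * N - l) * ?T1 + l * ?D - l * N / 2 * ?M"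
    unfolding edge_sum_linear Tdv dv e1 by simp
  moreover have "edge_sum (\<lambda>u v. 0) = 0" by (simp add: edge_sum_def)
  ultimately have upper: "3 * ?TC - 3 * ?Td + (3 / 2 * N - l) * ?T1 + l * ?D - l * N / 2 * ?M \<le> 0"
    by simp
  have step: "l * (?D - N / 2 * ?M) \<le> (l - N / 2) * ?T1"
    using upper slack by (simp add: algebra_simps)
  have T1: "0 \<le> ?T1" unfolding edge_sum_def using c0 a_nonneg by (intro sum_nonneg mult_nonneg_nonneg)
  have T1': "?T1 \<le> l / 3 * ?M"
    unfolding e1[symmetric] edge_sum_cmult[symmetric]
    by (rule edge_sum_mono) (use small in force)
  have gap: "0 < ?D - N / 2 * ?M"
  proof -
    have "N * (N / 2 * ?M) < ?M * ?M"
      using n M0 by (simp add: N_def power2_eq_square)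
    also have "\<dots> \<le> N * ?D" using D by (simp add: power2_eq_square)
    finally show ?thesis using N0 by simp
  qed
  show False
  \<comment> \<open>The sign of \<open>l - N / 2\<close> decides whether \<open>step\<close> calls
    for the lower bound 0 on \<open>?T1\<close> or for the upper bound \<open>T1'\<close>.\<close>
  proof (cases "N \<le> 2 * l")
    case False
    then have "(l - N / 2) * ?T1 \<le> 0" using T1 by (simp add: mult_le_0_iff)
    moreover have "0 < l * (?D - N / 2 * ?M)" using gap l by simp
    ultimately show False using step by linarith
  next
    case True
    have "l * (?D - N / 2 * ?M) \<le> (l - N / 2) * (l / 3 * ?M)"
      using step mult_left_mono[OF T1', of "l - N / 2"] True by linarith
    then have "l * (?D - N / 2 * ?M) \<le> l * ((l - N / 2) / 3 * ?M)" by (simp add: algebra_simps)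
    then have "?D - N / 2 * ?M \<le> (l - N / 2) / 3 * ?M" using l by simp
    then have "N * ?D \<le> N * ((l - N / 2) / 3 * ?M + N / 2 * ?M)"
      using N0 by (intro mult_left_mono) auto
    with D have "?M * ?M \<le> (N * ((l - N / 2) / 3 + N / 2)) * ?M"
      by (simp add: power2_eq_square algebra_simps)
    then have "?M \<le> N * ((l - N / 2) / 3 + N / 2)" using M0 by simp
    also have "\<dots> = N * (l + N) / 3" by (simp add: field_simps)
    finally have "6 * l\<^sup>2 < N * (l + N)" using M by simp
    moreover have "N * (l + N) \<le> 2 * l * (l + 2 * l)"
      using True N0 l by (intro mult_mono) auto
    ultimately show False by (simp add: power2_eq_square algebra_simps)
  qed
qed

end

section \<open>Isomorphism with the balanced complete bipartite graph\<close>

text \<open>Without parallel arcs an arc is determined by its ends, so a vertex bijection that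
  preserves and reflects adjacency induces the bijection on arcs.\<close>

lemma digraph_iso_with_proj_if_bij:
  assumes "nomulti_digraph G" and f: "bij_betw f (verts G) (pverts H)"
    and arcs: "\<And>u v. u \<in> verts G \<Longrightarrow> v \<in> verts G \<Longrightarrow> u \<rightarrow>\<^bsub>G\<^esub> v \<longleftrightarrow> (f u, f v) \<in> parcs H"
    and H: "parcs H \<subseteq> pverts H \<times> pverts H"
  shows "digraph_iso G (with_proj H)"
proof -
  interpret nomulti_digraph G by fact
  define h where "h = \<lparr>iso_verts = f, iso_arcs = (\<lambda>e. (f (tail G e), f (head G e))),
    iso_head = snd, iso_tail = fst\<rparr>"
  have inj: "inj_on f (verts G)" and im: "f ` verts G = pverts H"
    using f by (auto simp: bij_betw_def)
  have "inj_on (\<lambda>e. (f (tail G e), f (head G e))) (arcs G)"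
  proof (rule inj_onI)
    fix e e' assume e: "e \<in> arcs G" "e' \<in> arcs G" "(f (tail G e), f (head G e)) = (f (tail G e'), f (head G e'))"
    then have "arc_to_ends G e = arc_to_ends G e'"
      using inj by (simp add: arc_to_ends_def inj_on_eq_iff)
    then show "e = e'" using e by (intro no_multi_arcs)
  qed
  then have "digraph_isomorphism h"
    using inj wf_digraph_axioms by (simp add: digraph_isomorphism_def h_def)
  moreover have "(\<lambda>e. (f (tail G e), f (head G e))) ` arcs G = parcs H"
  proof (intro equalityI subsetI)
    fix p assume "p \<in> (\<lambda>e. (f (tail G e), f (head G e))) ` arcs G"
    then obtain e where e: "e \<in> arcs G" "p = (f (tail G e), f (head G e))" by blast
    then have "tail G e \<rightarrow>\<^bsub>G\<^esub> head G e" by (auto intro: dominatesI simp: arc_to_ends_def)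
    moreover have "tail G e \<in> verts G" "head G e \<in> verts G" using e(1) by simp_all
    ultimately show "p \<in> parcs H" using arcs[of "tail G e" "head G e"] e(2) by simp
  next
    fix p assume p: "p \<in> parcs H"
    then have "p \<in> f ` verts G \<times> f ` verts G" using H im by blast
    then obtain u v where uv: "u \<in> verts G" "v \<in> verts G" "p = (f u, f v)" by auto
    with p arcs[of u v] have "u \<rightarrow>\<^bsub>G\<^esub> v" by simp
    then obtain e where "e \<in> arcs G" "tail G e = u" "head G e = v" by (rule reachableE)
    then show "p \<in> (\<lambda>e. (f (tail G e), f (head G e))) ` arcs G"
      by (intro rev_image_eqI[of e]) (simp_all add: uv)
  qed
  then have "with_proj H = app_iso h G"
    by (simp add: app_iso_def h_def im with_proj_def)
  ultimately show ?thesis unfolding digraph_iso_def by blast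
qed

lemma digraph_iso_turan_bipartite:
  assumes "graph G" and "card (verts G) = n"
    and A: "A \<subseteq> verts G" "card A = n div 2"
    and adj: "\<And>u v. u \<in> verts G \<Longrightarrow> v \<in> verts G \<Longrightarrow> u \<rightarrow>\<^bsub>G\<^esub> v \<longleftrightarrow> (u \<in> A \<longleftrightarrow> v \<notin> A)"
  shows "digraph_iso G (with_proj (turan_bipartite n))"
proof -
  interpret graph G by fact
  let ?B = "verts G - A"
  have fin: "finite A" using A(1) finite_verts by (rule finite_subset)
  then have "card ?B = card {n div 2..<n}"
    using assms by (simp add: card_Diff_subset)
  then obtain g where g: "bij_betw g ?B {n div 2..<n}"
    using bij_betw_iff_card[of ?B "{n div 2..<n}"] by auto
  obtain h where h: "bij_betw h A {..<n div 2}"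
    using bij_betw_iff_card[of A "{..<n div 2}"] fin A by auto
  define f where "f u = (if u \<in> A then h u else g u)" for u
  have fA: "bij_betw f A {..<n div 2}"
    using h by (subst bij_betw_cong[of A f h]) (simp_all add: f_def)
  have fB: "bij_betw f ?B {n div 2..<n}"
    using g by (subst bij_betw_cong[of ?B f g]) (simp_all add: f_def)
  have "bij_betw f (A \<union> ?B) ({..<n div 2} \<union> {n div 2..<n})"
    by (rule bij_betw_combine[OF fA fB]) auto
  moreover have "A \<union> ?B = verts G" using A by auto
  ultimately have f: "bij_betw f (verts G) ({..<n div 2} \<union> {n div 2..<n})" by simp
  have lt_iff: "f w < n div 2 \<longleftrightarrow> w \<in> A" if "w \<in> verts G" for w
  proof (cases "w \<in> A")
    case True
    then show ?thesis using bij_betwE[OF fA] by simp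
  next
    case False
    then have "f w \<in> {n div 2..<n}" using bij_betwE[OF fB] that by simp
    then show ?thesis using False by simp
  qed
  have lt: "f w < n" if "w \<in> verts G" for w
    using bij_betwE[OF f] that by fastforce
  show ?thesis
  proof (rule digraph_iso_with_proj_if_bij[where f = f])
    show "nomulti_digraph G" ..
    show "bij_betw f (verts G) (pverts (turan_bipartite n))"
      using f by (simp add: turan_bipartite_def Let_def)
    show "parcs (turan_bipartite n) \<subseteq> pverts (turan_bipartite n) \<times> pverts (turan_bipartite n)"
      by (auto simp: turan_bipartite_def Let_def)
    fix u v assume uv: "u \<in> verts G" "v \<in> verts G"
    have "(f u, f v) \<in> parcs (turan_bipartite n) \<longleftrightarrow> (f u < n div 2 \<longleftrightarrow> \<not> f v < n div 2)"
      using lt[OF uv(1)] lt[OF uv(2)] by (auto simp: turan_bipartite_def Let_def)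
    then show "u \<rightarrow>\<^bsub>G\<^esub> v \<longleftrightarrow> (f u, f v) \<in> parcs (turan_bipartite n)"
      using lt_iff uv by (simp add: adj[OF uv])
  qed
qed

section \<open>Integer arithmetic of \<open>n\<^sup>2 div 4\<close>\<close>

lemma mult_le_square_div_4: "k * (n - k) \<le> n\<^sup>2 div 4" for k n :: nat
proof (cases "k \<le> n")
  case True
  then obtain j where "n = k + j" by (metis le_add_diff_inverse)
  moreover have "4 * (k * j) \<le> (k + j)\<^sup>2"
    using zero_le_power2[of "int k - int j"]
    by (simp flip: of_nat_le_iff[where 'a = int] add: power2_eq_square algebra_simps)
  ultimately show ?thesis by simp
qed simp

lemma div_2_times_eq: "n div 2 * (n - n div 2) = n\<^sup>2 div 4" for n :: nat
proof (cases "even n")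
  case True
  then obtain k where "n = 2 * k" by blast
  then show ?thesis by (simp add: power2_eq_square)
next
  case False
  then obtain k where "n = 2 * k + 1" by (elim oddE)
  then show ?thesis by (simp add: power2_eq_square algebra_simps)
qed

text \<open>A square is 0 or 1 modulo 4.\<close>

lemma square_le_div_4: "n\<^sup>2 \<le> 4 * (n\<^sup>2 div 4) + 1" for n :: nat
proof (cases "even n")
  case True
  then obtain k where "n = 2 * k" by blast
  then show ?thesis by (simp add: power2_eq_square)
next
  case False
  then obtain k where "n = 2 * k + 1" by (elim oddE)
  then have "n\<^sup>2 = 4 * (k * k + k) + 1" by (simp add: power2_eq_square algebra_simps)
  moreover have "(4 * q + 1) div 4 = q" for q :: nat by simp
  ultimately show ?thesis by (simp only:)
qed

text \<open>With \<open>j = n - k\<close> the rounding loses less than 4 in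
  \<open>4 * (k * j)\<close>, so the square of \<open>k - j\<close> is below 4 and the two parts
  differ by at most 1.\<close>

lemma balanced_if_mult_eq_square_div_4:
  fixes k n :: nat
  assumes "k \<le> n" "n\<^sup>2 div 4 \<le> k * (n - k)"
  shows "k = n div 2 \<or> n - k = n div 2"
proof -
  obtain j where n: "n = k + j" using assms(1) by (metis le_add_diff_inverse)
  have "(k + j)\<^sup>2 < 4 * (k * j) + 4"
    using assms(2) n by simp
  then have "(int k - int j)\<^sup>2 < 2\<^sup>2"
    by (simp flip: of_nat_less_iff[where 'a = int] add: power2_eq_square algebra_simps)
  then have "\<bar>int k - int j\<bar> < 2"
    using power2_less_imp_less[of "\<bar>int k - int j\<bar>" 2] by simp
  then show ?thesis using n by linarith
qed

section \<open>The extremal case of Mantel's theorem\<close>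

lemma (in graph) finite_neighborhood: "finite (neighborhood G u)"
  by (rule finite_subset[OF _ finite_verts]) (auto simp: neighborhood_def dest: adj_in_verts)

lemma (in graph) adj_commute: "u \<rightarrow> v \<longleftrightarrow> v \<rightarrow> u"
  by (rule iffI; erule arcs_ends_symmetric[OF sym_arcs])

text \<open>
  Take the neighbourhood of a vertex of maximum degree \<open>d\<close>. It is independent, so the \<open>n - d\<close> other
  vertices, each of degree at most \<open>d\<close>, cover all edges; in the extremal case they do so exactly once.
\<close>

lemma (in graph) complete_bipartite_if_triangle_free:
  assumes n: "card (verts G) = n" "0 < n"
    and tf: "\<And>u v w. u \<rightarrow> v \<Longrightarrow> u \<rightarrow> w \<Longrightarrow> \<not> v \<rightarrow> w"
    and m: "2 * (n\<^sup>2 div 4) \<le> (\<Sum>u\<in>verts G. card (neighborhood G u))"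
  obtains A where "(\<Sum>u\<in>verts G. card (neighborhood G u)) = 2 * (n\<^sup>2 div 4)"
    "A \<subseteq> verts G" "card A = n div 2"
    "\<And>u v. u \<in> verts G \<Longrightarrow> v \<in> verts G \<Longrightarrow> u \<rightarrow> v \<longleftrightarrow> (u \<in> A \<longleftrightarrow> v \<notin> A)"
proof -
  let ?N = "neighborhood G"
  define d where "d = Max ((\<lambda>u. card (?N u)) ` verts G)"
  have ne: "verts G \<noteq> {}" using n by auto
  then have "d \<in> (\<lambda>u. card (?N u)) ` verts G"
    unfolding d_def by (intro Max_in) auto
  then obtain x where x: "x \<in> verts G" "card (?N x) = d" by auto
  have deg_le: "card (?N u) \<le> d" if "u \<in> verts G" for u
    unfolding d_def using that by (intro Max_ge) auto
  define A where "A = ?N x"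
  define B where "B = verts G - A"
  have AV: "A \<subseteq> verts G" by (auto simp: A_def neighborhood_def dest: adj_in_verts)
  have finA: "finite A" using AV finite_verts by (rule finite_subset)
  have finB: "finite B" by (simp add: B_def)
  have cA: "card A = d" using x by (simp add: A_def)
  have cB: "card B = n - d" using n AV cA finA by (simp add: B_def card_Diff_subset)
  have dn: "d \<le> n" using card_mono[OF finite_verts AV] n cA by simp
  have indep: "\<not> u \<rightarrow> v" if "u \<in> A" "v \<in> A" for u v
    using that tf[of x u v] by (simp add: A_def neighborhood_def)
  have NA: "?N u \<subseteq> B" if "u \<in> A" for u
    using indep[OF that] by (auto simp: B_def neighborhood_def dest: adj_in_verts)
  \<comment> \<open>Double counting of the edges between \<open>A\<close> and
    \<open>B\<close>.\<close>
  have sumA: "(\<Sum>u\<in>A. card (?N u)) = (\<Sum>v\<in>B. card (?N v \<inter> A))"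
  proof -
    have "(\<Sum>u\<in>A. card (?N u)) = (\<Sum>u\<in>A. \<Sum>v\<in>B. of_bool (u \<rightarrow> v))"
    proof (rule sum.cong[OF refl])
      fix u assume "u \<in> A"
      then have "?N u = B \<inter> {v. u \<rightarrow> v}" using NA by (auto simp: neighborhood_def)
      then show "card (?N u) = (\<Sum>v\<in>B. of_bool (u \<rightarrow> v))"
        using finB by (simp add: sum_of_bool_eq)
    qed
    also have "\<dots> = (\<Sum>v\<in>B. \<Sum>u\<in>A. of_bool (u \<rightarrow> v))" by (rule sum.swap)
    also have "\<dots> = (\<Sum>v\<in>B. card (?N v \<inter> A))"
    proof (rule sum.cong[OF refl])
      fix v
      have "?N v \<inter> A = A \<inter> {u. u \<rightarrow> v}" by (auto simp: neighborhood_def adj_commute)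
      then show "(\<Sum>u\<in>A. of_bool (u \<rightarrow> v)) = card (?N v \<inter> A)"
        using finA by (simp add: sum_of_bool_eq)
    qed
    finally show ?thesis .
  qed
  have le1: "card (?N v \<inter> A) \<le> d" for v using card_mono[OF finA, of "?N v \<inter> A"] cA by auto
  have le2: "card (?N v) \<le> d" if "v \<in> B" for v using that deg_le by (auto simp: B_def)
  have sum1: "(\<Sum>v\<in>B. card (?N v \<inter> A)) \<le> (\<Sum>v\<in>B. d)" by (intro sum_mono le1)
  have sum2: "(\<Sum>v\<in>B. card (?N v)) \<le> (\<Sum>v\<in>B. d)" by (intro sum_mono le2)
  have VAB: "verts G = A \<union> B" and disj: "A \<inter> B = {}" using AV by (auto simp: B_def)
  have "(\<Sum>u\<in>verts G. card (?N u)) = (\<Sum>v\<in>B. card (?N v \<inter> A)) + (\<Sum>v\<in>B. card (?N v))"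
    unfolding VAB sum.union_disjoint[OF finA finB disj] sumA ..
  moreover have sumd: "(\<Sum>v\<in>B. d) = d * (n - d)" by (simp add: cB)
  moreover note mult_le_square_div_4[of d n]
  \<comment> \<open>The degree sum lies between \<open>2 * (n\<^sup>2 div 4)\<close> and
    \<open>2 * (d * (n - d))\<close>, which is at most \<open>2 * (n\<^sup>2 div 4)\<close>, so all
    estimates are equalities.\<close>
  ultimately have eq1: "(\<Sum>v\<in>B. card (?N v \<inter> A)) = (\<Sum>v\<in>B. d)"
    and eq2: "(\<Sum>v\<in>B. card (?N v)) = (\<Sum>v\<in>B. d)" and ext: "n\<^sup>2 div 4 \<le> d * (n - d)"
    and sum_eq: "(\<Sum>u\<in>verts G. card (?N u)) = 2 * (n\<^sup>2 div 4)"
    using m sum1 sum2 by linarith+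
  have NB: "?N v = A" if "v \<in> B" for v
  proof -
    have "card (?N v \<inter> A) = d"
      using sum_mono_inv[OF eq1 le1 that finB] .
    then have "?N v \<inter> A = A" using card_subset_eq[OF finA Int_lower2] cA by simp
    then have "A \<subseteq> ?N v" by blast
    moreover have "card (?N v) = d"
      using sum_mono_inv[OF eq2 le2 that finB] .
    ultimately show ?thesis using card_subset_eq[OF finite_neighborhood, of A v] cA by simp
  qed
  have adj: "u \<rightarrow> v \<longleftrightarrow> (u \<in> A \<longleftrightarrow> v \<notin> A)" if "u \<in> verts G" "v \<in> verts G" for u v
  proof -
    have iff: "w \<rightarrow> z \<longleftrightarrow> z \<in> A" if "w \<in> B" for w z using NB[OF that] by (auto simp: neighborhood_def)
    show ?thesis
      using iff[of u v] iff[of v u] adj_commute[of u v] indep[of u v] that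
      unfolding B_def by blast
  qed
  show thesis
  proof (cases "d = n div 2")
    case True
    then show ?thesis using that[OF sum_eq AV] cA adj by blast
  next
    \<comment> \<open>Here \<open>B\<close> is the part of size \<open>n div 2\<close>, and the two
      parts exchange roles.\<close>
    case False
    then have "card B = n div 2" using balanced_if_mult_eq_square_div_4[OF dn ext] cB by simp
    moreover have "u \<rightarrow> v \<longleftrightarrow> (u \<in> B \<longleftrightarrow> v \<notin> B)" if "u \<in> verts G" "v \<in> verts G" for u v
      using adj[OF that] that by (auto simp: B_def)
    ultimately show ?thesis using that[of B] sum_eq by (auto simp: B_def)
  qed
qed

section \<open>Spectral radius and eigenfunctions on the vertices\<close>

lemma adjacency_mat_carrier: "adjacency_mat G xs \<in> carrier_mat (length xs) (length xs)"
  by (simp add: adjacency_mat_def)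

lemma (in fin_digraph) norm_le_graph_spectral_radius:
  fixes k :: complex
  assumes f: "\<exists>u\<in>verts G. f u \<noteq> 0"
    and eig: "\<And>u. u \<in> verts G \<Longrightarrow> (\<Sum>w\<in>verts G. (if u \<rightarrow> w then 1 else 0) * f w) = k * f u"
  shows "norm k \<le> graph_spectral_radius G"
proof -
  obtain xs where xs: "set xs = verts G" "distinct xs"
    using finite_distinct_list[OF finite_verts] by blast
  have "eigenvalue (adjacency_mat G xs) k"
    unfolding eigenvalue_adjacency_mat_iff[OF xs(2)] xs(1) using assms by (intro exI[of _ f]) simp
  moreover have "0 < length xs" using f xs(1) by auto
  ultimately show ?thesis
    unfolding graph_spectral_radius_eq[OF xs(2,1)]
    by (intro spectral_radius_mem_max(2)[OF adjacency_mat_carrier]) (auto simp: spectrum_def)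
qed

lemma (in fin_digraph) graph_spectral_radius_attained:
  assumes "verts G \<noteq> {}"
  obtains k :: complex and f where "norm k = graph_spectral_radius G" "\<exists>u\<in>verts G. f u \<noteq> 0"
    "\<And>u. u \<in> verts G \<Longrightarrow> (\<Sum>w\<in>verts G. (if u \<rightarrow> w then 1 else 0) * f w) = k * f u"
proof -
  obtain xs where xs: "set xs = verts G" "distinct xs"
    using finite_distinct_list[OF finite_verts] by blast
  then have "0 < length xs" using assms by auto
  from spectral_radius_mem_max(1)[OF adjacency_mat_carrier this, of G]
  obtain k where k: "eigenvalue (adjacency_mat G xs) k" "graph_spectral_radius G = norm k"
    unfolding graph_spectral_radius_eq[OF xs(2,1)] by (auto simp: spectrum_def)
  from k(1) obtain f where "\<exists>u\<in>verts G. f u \<noteq> 0"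
    "\<forall>u\<in>verts G. (\<Sum>w\<in>verts G. (if u \<rightarrow> w then 1 else 0) * f w) = k * f u"
    unfolding eigenvalue_adjacency_mat_iff[OF xs(2)] xs(1) by blast
  with k(2) show ?thesis by (intro that[of k f]) simp_all
qed

lemma sqrt_le_graph_spectral_radius_turan_bipartite:
  assumes "2 \<le> n"
  shows "sqrt (real (n\<^sup>2 div 4)) \<le> graph_spectral_radius (with_proj (turan_bipartite n))"
proof -
  let ?T = "with_proj (turan_bipartite n)"
  define a where "a = n div 2"
  define b where "b = n - n div 2"
  have "complete_bipartite_digraph a b ?T"
    unfolding a_def b_def by (rule complete_bipartite_turan_bipartite)
  then interpret T: graph ?T by (simp add: complete_bipartite_digraph_def)
  \<comment> \<open>An eigenfunction for \<open>sqrt (a * b)\<close>: a vertex on the side of size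
    \<open>a\<close> sees \<open>b\<close> vertices of weight \<open>sqrt a\<close>, and
    \<open>b * sqrt a = sqrt (a * b) * sqrt b\<close>.\<close>
  define f where "f u = complex_of_real (if u < a then sqrt b else sqrt a)" for u
  have V: "verts ?T = {..<a} \<union> {a..<n}" by (auto simp: turan_bipartite_def Let_def a_def)
  have adj: "u \<rightarrow>\<^bsub>?T\<^esub> w \<longleftrightarrow> (u < a \<longleftrightarrow> a \<le> w)" if "u < n" "w < n" for u w
    using that by (auto simp: turan_bipartite_def Let_def a_def)
  have an: "a \<le> n" "0 < a" "n - a = b" "0 < b" using assms by (auto simp: a_def b_def)
  have "norm (complex_of_real (sqrt (a * b))) \<le> graph_spectral_radius ?T"
  proof (rule T.norm_le_graph_spectral_radius)
    show "\<exists>u\<in>verts ?T. f u \<noteq> 0" using an V by (intro bexI[of _ 0]) (auto simp: f_def)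
    fix u assume u: "u \<in> verts ?T"
    then have un: "u < n" using an V by auto
    have "(\<Sum>w\<in>verts ?T. (if u \<rightarrow>\<^bsub>?T\<^esub> w then 1 else 0) * f w)
      = (\<Sum>w<a. (if u \<rightarrow>\<^bsub>?T\<^esub> w then 1 else 0) * f w)
        + (\<Sum>w=a..<n. (if u \<rightarrow>\<^bsub>?T\<^esub> w then 1 else 0) * f w)"
      unfolding V by (rule sum.union_disjoint) auto
    also have "(\<Sum>w<a. (if u \<rightarrow>\<^bsub>?T\<^esub> w then 1 else 0) * f w)
      = (\<Sum>w<a. if u < a then 0 else complex_of_real (sqrt b))"
    proof (rule sum.cong[OF refl])
      fix w assume "w \<in> {..<a}"
      then show "(if u \<rightarrow>\<^bsub>?T\<^esub> w then 1 else 0) * f w = (if u < a then 0 else complex_of_real (sqrt b))"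
        using adj[OF un, of w] an by (simp add: f_def)
    qed
    also have "(\<Sum>w=a..<n. (if u \<rightarrow>\<^bsub>?T\<^esub> w then 1 else 0) * f w)
      = (\<Sum>w=a..<n. if u < a then complex_of_real (sqrt a) else 0)"
    proof (rule sum.cong[OF refl])
      fix w assume "w \<in> {a..<n}"
      then show "(if u \<rightarrow>\<^bsub>?T\<^esub> w then 1 else 0) * f w = (if u < a then complex_of_real (sqrt a) else 0)"
        using adj[OF un, of w] by (simp add: f_def)
    qed
    also have "(\<Sum>w<a. if u < a then 0 else complex_of_real (sqrt b))
        + (\<Sum>w=a..<n. if u < a then complex_of_real (sqrt a) else 0)
      = complex_of_real (if u < a then b * sqrt a else a * sqrt b)"
      using an by simp
    also have "(if u < a then b * sqrt a else a * sqrt b) = sqrt (a * b) * (if u < a then sqrt b else sqrt a)"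
      by (simp add: real_sqrt_mult)
    also have "complex_of_real \<dots> = complex_of_real (sqrt (a * b)) * f u"
      unfolding f_def by (rule of_real_mult)
    finally show "(\<Sum>w\<in>verts ?T. (if u \<rightarrow>\<^bsub>?T\<^esub> w then 1 else 0) * f w) = complex_of_real (sqrt (a * b)) * f u" .
  qed
  moreover have "a * b = n\<^sup>2 div 4" using div_2_times_eq by (simp add: a_def b_def)
  ultimately show ?thesis by (simp flip: of_nat_mult)
qed

section \<open>Graphs of small booksize\<close>

lemma (in graph) codegree_le_booksize:
  assumes "u \<rightarrow> v"
  shows "card (neighborhood G u \<inter> neighborhood G v) \<le> booksize G"
proof -
  let ?S = "{card (neighborhood G u \<inter> neighborhood G v) | u v. u \<rightarrow> v}"
  have "?S \<subseteq> (\<lambda>(u, v). card (neighborhood G u \<inter> neighborhood G v)) ` (verts G \<times> verts G)"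
    by (auto dest: adj_in_verts)
  then have "finite ?S" by (rule finite_subset) auto
  then show ?thesis unfolding booksize_def using assms by (intro Max_ge) auto
qed

text \<open>The dense case would give an edge of too large codegree. Otherwise the weight
  \<open>y\<close> shows that the graph is triangle-free with \<open>?l\<^sup>2\<close> edges, hence
  extremal. Recording the value of \<open>?l\<^sup>2\<close> lets a strict spectral inequality be
  refuted numerically, without transporting the radius along an isomorphism.\<close>

lemma (in graph) turan_bipartite_if_booksize_small:
  assumes n: "card (verts G) = n" "2 \<le> n"
    and l: "real (n\<^sup>2 div 4) \<le> (graph_spectral_radius G)\<^sup>2" "0 < graph_spectral_radius G"
    and small: "3 * booksize G < graph_spectral_radius G"
  shows "(graph_spectral_radius G)\<^sup>2 = real (n\<^sup>2 div 4) \<and> digraph_iso G (with_proj (turan_bipartite n))"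
proof -
  let ?l = "graph_spectral_radius G" and ?N = "neighborhood G"
  define a :: "'a \<Rightarrow> 'a \<Rightarrow> real" where "a u v = of_bool (u \<rightarrow> v)" for u v
  interpret Z: zero_one_symmetric "verts G" a
    by unfold_locales (simp_all add: a_def adj_commute)
  have N: "?N u = verts G \<inter> {w. u \<rightarrow> w}" for u by (auto simp: neighborhood_def dest: adj_in_verts)
  have codeg: "Z.codegree u v = card (?N u \<inter> ?N v)" for u v
  proof -
    have "?N u \<inter> ?N v = verts G \<inter> {w. u \<rightarrow> w \<and> v \<rightarrow> w}" unfolding N by blast
    moreover have "Z.codegree u v = (\<Sum>w\<in>verts G. of_bool (u \<rightarrow> w \<and> v \<rightarrow> w))"
      by (simp add: Z.codeg_def a_def of_bool_conj)
    ultimately show ?thesis by (simp add: sum_of_bool_eq)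
  qed
  have deg: "Z.deg (\<lambda>_. 1) u = card (?N u)" for u
    by (simp add: Z.deg_def a_def N sum_of_bool_eq)
  have mass: "Z.mass (Z.deg (\<lambda>_. 1)) = (\<Sum>u\<in>verts G. card (?N u))"
    by (simp add: Z.mass_def deg)
  have cod: "3 * Z.codegree u v < ?l" if "a u v = 1" for u v
  proof -
    have "u \<rightarrow> v" using that by (simp add: a_def split: if_splits)
    from codegree_le_booksize[OF this] small show ?thesis unfolding codeg by linarith
  qed
  have ne: "verts G \<noteq> {}" using n by auto
  obtain k :: complex and f where k: "norm k = ?l" and f: "\<exists>u\<in>verts G. f u \<noteq> 0"
    and eig: "\<And>u. u \<in> verts G \<Longrightarrow> (\<Sum>w\<in>verts G. (if u \<rightarrow> w then 1 else 0) * f w) = k * f u"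
    by (rule graph_spectral_radius_attained[OF ne], rule that)
  define y where "y u = norm (f u)" for u
  have super: "?l * y u \<le> Z.deg y u" if "u \<in> verts G" for u
  proof -
    \<comment> \<open>The triangle inequality for the eigenvalue equation makes the modulus of the
      eigenfunction satisfy \<open>super\<close>.\<close>
    have "?l * y u = norm (\<Sum>w\<in>verts G. (if u \<rightarrow> w then 1 else 0) * f w)"
      by (simp add: eig[OF that] y_def norm_mult k)
    also have "\<dots> \<le> (\<Sum>w\<in>verts G. norm ((if u \<rightarrow> w then 1 else 0) * f w))" by (rule norm_sum)
    also have "\<dots> = Z.deg y u"
      unfolding Z.deg_def by (intro sum.cong refl) (simp add: a_def y_def norm_mult)
    finally show ?thesis .
  qed
  have y0: "0 \<le> y u" for u by (simp add: y_def)
  have mass_y: "0 < Z.mass y"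
  proof -
    obtain u where "u \<in> verts G" "0 < y u" using f by (auto simp: y_def)
    then show ?thesis unfolding Z.mass_def using y0 by (intro sum_pos2) auto
  qed
  have M: "Z.mass (Z.deg (\<lambda>_. 1)) \<le> 2 * ?l\<^sup>2"
  proof (rule ccontr)
    assume *: "\<not> ?thesis"
    then have "real (2 * (n\<^sup>2 div 4)) < real (\<Sum>u\<in>verts G. card (?N u))"
      using l(1) mass by simp
    then have "2 * (n\<^sup>2 div 4) < (\<Sum>u\<in>verts G. card (?N u))"
      by (simp only: of_nat_less_iff)
    \<comment> \<open>Integrality makes the degree sum at least
      \<open>2 * (n\<^sup>2 div 4) + 1\<close>; its double exceeds
      \<open>4 * (n\<^sup>2 div 4) + 1\<close>.\<close>
    with square_le_div_4[of n] have "n\<^sup>2 < 2 * (\<Sum>u\<in>verts G. card (?N u))" by linarith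
    then have "real ((card (verts G))\<^sup>2) < 2 * Z.mass (Z.deg (\<lambda>_. 1))"
      unfolding mass n by (simp flip: of_nat_less_iff[where 'a = real])
    with * obtain u v where "a u v = 1" "?l < 3 * Z.codegree u v"
      using Z.exists_codegree_large_if_dense[OF l(2)] by (meson not_le)
    with cod[of u v] show False by linarith
  qed
  note eq = Z.triangle_free_if_codegree_small[OF y0 mass_y super l(2) M cod]
  have tf: "\<not> v \<rightarrow> w" if "u \<rightarrow> v" "u \<rightarrow> w" for u v w
    using eq(2)[of u v w] that adj_in_verts[OF that(1)] adj_in_verts[OF that(2)] by (simp add: a_def)
  have "real (2 * (n\<^sup>2 div 4)) \<le> real (\<Sum>u\<in>verts G. card (?N u))"
    using l(1) eq(1) mass by simp
  then have m: "2 * (n\<^sup>2 div 4) \<le> (\<Sum>u\<in>verts G. card (?N u))"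
    by (simp only: of_nat_le_iff)
  obtain A where sum_eq: "(\<Sum>u\<in>verts G. card (?N u)) = 2 * (n\<^sup>2 div 4)"
    and A: "A \<subseteq> verts G" "card A = n div 2"
    "\<And>u v. u \<in> verts G \<Longrightarrow> v \<in> verts G \<Longrightarrow> u \<rightarrow> v \<longleftrightarrow> (u \<in> A \<longleftrightarrow> v \<notin> A)"
  proof (rule complete_bipartite_if_triangle_free[OF n(1) _ _ m])
    show "0 < n" using n(2) by simp
    show "\<not> v \<rightarrow> w" if "u \<rightarrow> v" "u \<rightarrow> w" for u v w by (rule tf[OF that])
  qed (rule that)
  have "digraph_iso G (with_proj (turan_bipartite n))"
    by (rule digraph_iso_turan_bipartite[OF graph_axioms n(1) A])
  moreover have "?l\<^sup>2 = real (n\<^sup>2 div 4)"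
    using eq(1) unfolding mass sum_eq by simp
  ultimately show ?thesis by blast
qed

section \<open>Graphs with at most one vertex\<close>

lemma (in graph) no_arcs_if_card_verts_le_1:
  assumes "card (verts G) \<le> 1"
  shows "\<not> u \<rightarrow> v"
proof
  assume uv: "u \<rightarrow> v"
  then have "u = v"
    using assms card_le_Suc0_iff_eq[OF finite_verts] adj_in_verts[OF uv] by auto
  with uv show False using adj_not_same by blast
qed

lemma (in graph) digraph_iso_turan_bipartite_if_trivial:
  assumes "card (verts G) = n" "n \<le> 1"
  shows "digraph_iso G (with_proj (turan_bipartite n))"
proof (rule digraph_iso_turan_bipartite[OF graph_axioms assms(1)])
  show "card {} = n div 2" using assms(2) by simp
  show "u \<rightarrow> v \<longleftrightarrow> (u \<in> {} \<longleftrightarrow> v \<notin> {})" for u v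
    using no_arcs_if_card_verts_le_1 assms by simp
qed simp

text \<open>The adjacency matrices are literally equal, which covers the empty graph too, where the
  spectrum is empty and the radius an unspecified value.\<close>

lemma graph_spectral_radius_eq_if_trivial:
  assumes "graph G" "graph H" and card: "card (verts G) = card (verts H)" "card (verts H) \<le> 1"
  shows "graph_spectral_radius G = graph_spectral_radius H"
proof -
  interpret G: graph G by fact
  interpret H: graph H by fact
  obtain xs where xs: "set xs = verts G" "distinct xs"
    using finite_distinct_list[OF G.finite_verts] by blast
  obtain ys where ys: "set ys = verts H" "distinct ys"
    using finite_distinct_list[OF H.finite_verts] by blast
  have "length xs = length ys" using card xs ys by (metis distinct_card)
  moreover have "\<not> u \<rightarrow>\<^bsub>G\<^esub> v" for u v using G.no_arcs_if_card_verts_le_1 card by simp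
  moreover have "\<not> u \<rightarrow>\<^bsub>H\<^esub> v" for u v using H.no_arcs_if_card_verts_le_1 card by simp
  ultimately have "adjacency_mat G xs = adjacency_mat H ys"
    unfolding adjacency_mat_def by simp
  then show ?thesis
    using graph_spectral_radius_eq[OF xs(2,1)] graph_spectral_radius_eq[OF ys(2,1)] by simp
qed

section \<open>The bounds on the booksize\<close>

lemma graph_turan_bipartite: "graph (with_proj (turan_bipartite n))"
  using complete_bipartite_turan_bipartite[of n] by (simp add: complete_bipartite_digraph_def)

lemma card_verts_turan_bipartite: "card (verts (with_proj (turan_bipartite n))) = n"
proof -
  have "{..<n div 2} \<union> {n div 2..<n} = {..<n}" by auto
  then show ?thesis by (simp add: turan_bipartite_def Let_def)
qed

theorem theorem1p2:
  fixes G :: "('a, 'b) pre_digraph" and n :: nat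
  assumes "graph G" and "card (verts G) = n"
  shows "(graph_spectral_radius G \<ge> graph_spectral_radius (with_proj (turan_bipartite n)) \<and>
          \<not> digraph_iso G (with_proj (turan_bipartite n))
            \<longrightarrow> real (booksize G) \<ge> 1 / 3 * graph_spectral_radius G) \<and>
         (graph_spectral_radius G > graph_spectral_radius (with_proj (turan_bipartite n))
            \<longrightarrow> int (booksize G) \<ge> \<lfloor>real n / 6\<rfloor> + 1)"
proof (cases "2 \<le> n")
  case False
  \<comment> \<open>With at most one vertex the premises of both claims fail.\<close>
  then have "digraph_iso G (with_proj (turan_bipartite n))"
    using graph.digraph_iso_turan_bipartite_if_trivial[OF assms] by simp
  moreover have "graph_spectral_radius G = graph_spectral_radius (with_proj (turan_bipartite n))"
    using False assms(2)
    by (intro graph_spectral_radius_eq_if_trivial[OF assms(1) graph_turan_bipartite])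
      (simp_all only: card_verts_turan_bipartite)
  ultimately show ?thesis by simp
next
  case True
  interpret graph G by fact
  let ?l = "graph_spectral_radius G"
  let ?t = "graph_spectral_radius (with_proj (turan_bipartite n))"
  have t: "sqrt (real (n\<^sup>2 div 4)) \<le> ?t"
    using sqrt_le_graph_spectral_radius_turan_bipartite[OF True] .
  have "2\<^sup>2 \<le> n\<^sup>2" using True by (rule power_mono) simp
  then have pos: "0 < real (n\<^sup>2 div 4)" by simp
  have large: "real (n\<^sup>2 div 4) \<le> ?l\<^sup>2" "0 < ?l" if "?t \<le> ?l"
  proof -
    have *: "sqrt (real (n\<^sup>2 div 4)) \<le> ?l" using t that by linarith
    then show "0 < ?l" using pos by (meson less_le_trans real_sqrt_gt_zero)
    show "real (n\<^sup>2 div 4) \<le> ?l\<^sup>2" using * by (rule sqrt_le_D)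
  qed
  have book: "?l \<le> 3 * booksize G" if "?t \<le> ?l"
    "\<not> (?l\<^sup>2 = real (n\<^sup>2 div 4) \<and> digraph_iso G (with_proj (turan_bipartite n)))"
    using turan_bipartite_if_booksize_small[OF assms(2) True large[OF that(1)]] that(2) by force
  have "\<lfloor>real n / 6\<rfloor> + 1 \<le> int (booksize G)" if lt: "?t < ?l"
  proof -
    \<comment> \<open>Strictness rules out \<open>?l\<^sup>2 = real (n\<^sup>2 div 4)\<close>, the
      exceptional case of \<open>book\<close>.\<close>
    have "sqrt (real (n\<^sup>2 div 4)) < ?l" using t lt by linarith
    then have "(sqrt (real (n\<^sup>2 div 4)))\<^sup>2 < ?l\<^sup>2" by (rule power_strict_mono) simp_all
    then have less: "real (n\<^sup>2 div 4) < ?l\<^sup>2" by (simp only: real_sqrt_pow2 of_nat_0_le_iff)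
    then have "?l \<le> 3 * booksize G" using book lt by simp
    then have "?l\<^sup>2 \<le> (3 * real (booksize G))\<^sup>2" using large(2) lt by (intro power_mono) auto
    with less have "real (n\<^sup>2 div 4) < real ((3 * booksize G)\<^sup>2)" by simp
    then have "n\<^sup>2 div 4 < (3 * booksize G)\<^sup>2" by (simp only: of_nat_less_iff)
    \<comment> \<open>The strict inequality between naturals gains 4 after multiplication by 4, more
      than the 1 lost to rounding.\<close>
    with square_le_div_4[of n] have "n\<^sup>2 < 4 * (3 * booksize G)\<^sup>2" by linarith
    then have "n\<^sup>2 < (6 * booksize G)\<^sup>2" by (simp add: power_mult_distrib)
    then have "n < 6 * booksize G" by (rule power_less_imp_less_base) simp
    then show ?thesis by linarith
  qed
  moreover have "1 / 3 * ?l \<le> booksize G"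
    if "?t \<le> ?l" "\<not> digraph_iso G (with_proj (turan_bipartite n))"
    using book that by simp
  ultimately show ?thesis by blast
qed

end
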